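(* Let $(P,\leq)$ be a poset and $a,b\in P$ with $a\neq b$. Define $f_{ab}\colon P\to P$ by $f_{ab}(a)=b$ and $f_{ab}(x)=x$ for $x\neq a$. Then $f_{ab}$ is strictly upper cone preserving if and only if $|L(a)|\leq2$ and $U^*(a)=U(b)$.
   Context: For $A\subseteq P$, $U(A)=\{x\in P\mid a\leq x\text{ for all }a\in A\}$ and $L(A)=\{x\in P\mid x\leq a\text{ for all }a\in A\}$; write $U(x,y)=U(\{x,y\})$, $U(x)=U(\{x\})$, $L(x)=L(\{x\})$, and $U^*(x)=U(x)\setminus\{x\}$. A mapping $f\colon P\to P$ is strictly upper cone preserving if $f(U(x,y))=U(f(x),f(y))$ for all $x,y\in P$ with $x\neq y$. *)

theory Defs
  imports Main
begin

definition upper_cone :: "'a::order set \<Rightarrow> 'a set" where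
  "upper_cone A = {x. \<forall>a\<in>A. a \<le> x}"

definition lower_cone :: "'a::order set \<Rightarrow> 'a set" where
  "lower_cone A = {x. \<forall>a\<in>A. x \<le> a}"

definition strict_upper_cone :: "'a::order \<Rightarrow> 'a set" where
  "strict_upper_cone x = upper_cone {x} - {x}"

definition strictly_upper_cone_preserving :: "('a::order \<Rightarrow> 'a) \<Rightarrow> bool" where
  "strictly_upper_cone_preserving f \<longleftrightarrow>
     (\<forall>x y. x \<noteq> y \<longrightarrow> f ` upper_cone {x, y} = upper_cone {f x, f y})"

definition f_map :: "'a \<Rightarrow> 'a \<Rightarrow> 'a \<Rightarrow> 'a" where
  "f_map a b x = (if x = a then b else x)"

end

theory Submission
  imports Defs
begin

text \<open>
  A point above both \<open>f x\<close> and \<open>f y\<close> with \<open>x \<noteq> y\<close> is a value of a strictly upper cone preserving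
  \<open>f\<close>, but \<open>f_map a b\<close> omits the value \<open>a\<close>. Hence two distinct elements cannot both lie below \<open>a\<close>,
  and \<open>b \<le> a\<close> is impossible because \<open>a\<close> and \<open>b\<close> are both mapped to \<open>b\<close>. As \<open>f_map a b\<close> is
  monotone, \<open>a < x\<close> implies \<open>b \<le> x\<close>. Conversely, the only cones \<open>U(x, y)\<close> with \<open>x \<noteq> y\<close> that
  contain \<open>a\<close> are \<open>U(a, y) = U(a)\<close> with \<open>y < a\<close>, and moving \<open>a\<close> to \<open>b\<close> turns \<open>U(a)\<close> into
  \<open>U(b)\<close>.
\<close>

lemma upper_cone_empty [simp]: "upper_cone {} = UNIV"
  by (simp add: upper_cone_def)

lemma upper_cone_insert [simp]: "upper_cone (insert x A) = {x..} \<inter> upper_cone A"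
  by (auto simp: upper_cone_def)

lemma lower_cone_singleton: "lower_cone {x} = {..x}"
  by (auto simp: lower_cone_def)

lemma strict_upper_cone_eq_greaterThan: "strict_upper_cone x = {x<..}"
  by (auto simp: strict_upper_cone_def less_le)

lemma finite_card_le_1_iff_Uniq: "finite A \<and> card A \<le> 1 \<longleftrightarrow> (\<exists>\<^sub>\<le>\<^sub>1x. x \<in> A)"
proof
  assume "finite A \<and> card A \<le> 1"
  then show "\<exists>\<^sub>\<le>\<^sub>1x. x \<in> A"
    by (auto simp: card_le_Suc0_iff_eq Uniq_def)
next
  assume "\<exists>\<^sub>\<le>\<^sub>1x. x \<in> A"
  then obtain x where "A \<subseteq> {x}"
    by (auto simp flip: subset_singleton_iff_Uniq)
  then show "finite A \<and> card A \<le> 1"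
    by (auto simp: subset_singleton_iff)
qed

lemma finite_card_atMost_le_2_iff_Uniq:
  fixes a :: "'a::order"
  shows "finite {..a} \<and> card {..a} \<le> 2 \<longleftrightarrow> (\<exists>\<^sub>\<le>\<^sub>1x. x < a)"
proof -
  have "{..a} = insert a {..<a}"
    by (auto simp: le_less)
  then have "finite {..a} \<and> card {..a} \<le> 2 \<longleftrightarrow> finite {..<a} \<and> card {..<a} \<le> 1"
    by auto
  then show ?thesis
    by (simp add: finite_card_le_1_iff_Uniq del: One_nat_def)
qed

lemma strictly_upper_cone_preserving_iff:
  "strictly_upper_cone_preserving f \<longleftrightarrow>
    (\<forall>x y. x \<noteq> y \<longrightarrow> f ` ({x..} \<inter> {y..}) = {f x..} \<inter> {f y..})"
  by (simp add: strictly_upper_cone_preserving_def)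

lemma strictly_upper_cone_preserving_imp_mono:
  assumes "strictly_upper_cone_preserving f"
  shows "mono f"
proof (rule monoI)
  fix x y :: 'a
  assume "x \<le> y"
  show "f x \<le> f y"
  proof (cases "x = y")
    case False
    have "f y \<in> f ` ({x..} \<inter> {y..})"
      using \<open>x \<le> y\<close> by auto
    also have "\<dots> = {f x..} \<inter> {f y..}"
      using assms False by (simp add: strictly_upper_cone_preserving_iff)
    finally show ?thesis
      by simp
  qed simp
qed

lemma strictly_upper_cone_preserving_upper_boundE:
  assumes "strictly_upper_cone_preserving f" and "x \<noteq> y" and "f x \<le> z" and "f y \<le> z"
  obtains w where "x \<le> w" and "y \<le> w" and "f w = z"
proof -
  have "z \<in> {f x..} \<inter> {f y..}"
    using assms by simp
  also have "\<dots> = f ` ({x..} \<inter> {y..})"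
    using assms by (simp add: strictly_upper_cone_preserving_iff)
  finally show thesis
    using that by auto
qed

lemma strictly_upper_cone_preserving_not_upper_bound:
  assumes "strictly_upper_cone_preserving f" and "z \<notin> range f" and "x \<noteq> y"
  shows "\<not> (f x \<le> z \<and> f y \<le> z)"
  using assms by (blast elim: strictly_upper_cone_preserving_upper_boundE)

lemma f_map_same [simp]: "f_map a b a = b"
  by (simp add: f_map_def)

lemma f_map_other [simp]: "x \<noteq> a \<Longrightarrow> f_map a b x = x"
  by (simp add: f_map_def)

lemma image_f_map: "f_map a b ` A = (if a \<in> A then insert b (A - {a}) else A)"
  by (auto simp: f_map_def image_iff)

lemma notin_range_f_map: "a \<noteq> b \<Longrightarrow> a \<notin> range (f_map a b)"
  by (simp add: image_f_map)

lemma f_map_preserving_imp_Uniq_less: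
  assumes "strictly_upper_cone_preserving (f_map a b)" and "a \<noteq> b"
  shows "\<exists>\<^sub>\<le>\<^sub>1x. x < a"
proof (rule Uniq_I, rule ccontr)
  fix x y
  assume "x < a" "y < a" "y \<noteq> x"
  then have "f_map a b x \<le> a" "f_map a b y \<le> a"
    by simp_all
  with \<open>y \<noteq> x\<close> show False
    using strictly_upper_cone_preserving_not_upper_bound[OF assms(1) notin_range_f_map]
      \<open>a \<noteq> b\<close> by blast
qed

lemma f_map_preserving_imp_less:
  assumes preserving: "strictly_upper_cone_preserving (f_map a b)" and "a \<noteq> b"
  shows "a < b"
proof -
  have same_value: "f_map a b a = b" "f_map a b b = b"
    using \<open>a \<noteq> b\<close> by simp_all
  have "\<not> b \<le> a"
    using strictly_upper_cone_preserving_not_upper_bound[OF preserving notin_range_f_map, of a b]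
      \<open>a \<noteq> b\<close> same_value by simp
  obtain w where "a \<le> w" "b \<le> w" "f_map a b w = b"
    using strictly_upper_cone_preserving_upper_boundE[OF preserving \<open>a \<noteq> b\<close>, of b] same_value
    by auto
  with \<open>\<not> b \<le> a\<close> have "w = b"
    by (metis f_map_other)
  with \<open>a \<le> w\<close> \<open>a \<noteq> b\<close> show ?thesis
    by simp
qed

lemma f_map_preserving_imp_greaterThan_eq_atLeast:
  assumes "strictly_upper_cone_preserving (f_map a b)" and "a \<noteq> b"
  shows "{a<..} = {b..}"
proof
  show "{a<..} \<subseteq> {b..}"
  proof
    fix x
    assume "x \<in> {a<..}"
    then have "f_map a b a \<le> f_map a b x"
      using monoD[OF strictly_upper_cone_preserving_imp_mono[OF assms(1)], of a x] by simp
    with \<open>x \<in> {a<..}\<close> show "x \<in> {b..}"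
      by auto
  qed
  show "{b..} \<subseteq> {a<..}"
    using f_map_preserving_imp_less[OF assms] by auto
qed

lemma image_f_map_upper_cone_source:
  fixes a b y :: "'a::order"
  assumes greaterThan_eq: "{a<..} = {b..}" and "y \<noteq> a"
  shows "f_map a b ` ({a..} \<inter> {y..}) = {b..} \<inter> {y..}"
proof (cases "y < a")
  case True
  have "a < b"
    using greaterThan_eq by (simp add: set_eq_iff)
  have "f_map a b ` ({a..} \<inter> {y..}) = f_map a b ` {a..}"
    using True by (auto intro!: arg_cong[where f = "image _"])
  also have "\<dots> = insert b {a<..}"
    by (auto simp: image_f_map less_le)
  also have "\<dots> = {b..}"
    using greaterThan_eq by auto
  also have "\<dots> = {b..} \<inter> {y..}"
    using True \<open>a < b\<close> by auto
  finally show ?thesis .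
next
  case False
  with \<open>y \<noteq> a\<close> have "\<not> y \<le> a"
    by simp
  then have "f_map a b ` ({a..} \<inter> {y..}) = {a..} \<inter> {y..}"
    by (simp add: image_f_map)
  also have "\<dots> = {a<..} \<inter> {y..}"
    using \<open>\<not> y \<le> a\<close> by (auto simp: less_le)
  finally show ?thesis
    by (simp add: greaterThan_eq)
qed

lemma image_f_map_upper_cone_other:
  fixes a x y :: "'a::order"
  assumes "\<exists>\<^sub>\<le>\<^sub>1z. z < a" and "x \<noteq> y" and "x \<noteq> a" and "y \<noteq> a"
  shows "f_map a b ` ({x..} \<inter> {y..}) = {x..} \<inter> {y..}"
proof -
  have "\<not> (x \<le> a \<and> y \<le> a)"
    using assms by (auto simp: Uniq_def less_le)
  then show ?thesis
    by (auto simp: image_f_map)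
qed

lemma f_map_preservingI:
  fixes a b :: "'a::order"
  assumes Uniq_less: "\<exists>\<^sub>\<le>\<^sub>1x. x < a" and greaterThan_eq: "{a<..} = {b..}"
  shows "strictly_upper_cone_preserving (f_map a b)"
  unfolding strictly_upper_cone_preserving_iff
proof (intro allI impI)
  fix x y :: 'a
  assume "x \<noteq> y"
  then consider (left) "x = a" "y \<noteq> a" | (right) "y = a" "x \<noteq> a" | (neither) "x \<noteq> a" "y \<noteq> a"
    by blast
  then show "f_map a b ` ({x..} \<inter> {y..}) = {f_map a b x..} \<inter> {f_map a b y..}"
  proof cases
    case left
    with image_f_map_upper_cone_source[OF greaterThan_eq] show ?thesis
      by simp
  next
    case right
    with image_f_map_upper_cone_source[OF greaterThan_eq, of x] show ?thesis
      by (simp add: Int_commute)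
  next
    case neither
    with image_f_map_upper_cone_other[OF Uniq_less \<open>x \<noteq> y\<close>] show ?thesis
      by simp
  qed
qed

theorem theorem3p4:
  fixes a b :: "'a::order"
  assumes "a \<noteq> b"
  shows "strictly_upper_cone_preserving (f_map a b) \<longleftrightarrow>
    (finite (lower_cone {a}) \<and> card (lower_cone {a}) \<le> 2) \<and>
    strict_upper_cone a = upper_cone {b}"
proof -
  have "strictly_upper_cone_preserving (f_map a b) \<longleftrightarrow> (\<exists>\<^sub>\<le>\<^sub>1x. x < a) \<and> {a<..} = {b..}"
    using assms f_map_preserving_imp_Uniq_less f_map_preserving_imp_greaterThan_eq_atLeast
      f_map_preservingI by blast
  then show ?thesis
    by (simp add: lower_cone_singleton strict_upper_cone_eq_greaterThan
        finite_card_atMost_le_2_iff_Uniq)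
qed

end
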